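(* Let $S \subseteq \overline{\mathbb{Z}}$. Let $\{f_n(X)/d_n\}_{n \geq 0}$ be a regular basis for $\mathrm{Int}_{\mathbb{Q}}(S,\overline{\mathbb{Z}})$ such that each $f_n \in \mathbb{Z}[X]$ is monic and each $d_n$ is a positive integer. Let $\mathscr{F} = \{f_n(X)/d_n \mid d_n \geq 2\}$. (1) $\mathrm{Int}_{\mathbb{Q}}(S,\overline{\mathbb{Z}})$ is nontrivial (i.e. different from $\mathbb{Z}[X]$) if and only if $\mathscr{F} \ne \varnothing$. (2) The polynomial closure of $S$ in $\overline{\mathbb{Z}}$ is $\displaystyle\bigcap_{f(X)/d \in \mathscr{F}} \mathscr{S}(f,d)$ (where an intersection over the empty family of subsets of $\overline{\mathbb{Z}}$ is $\overline{\mathbb{Z}}$).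
   Context: $\overline{\mathbb{Z}}$ is the ring of all algebraic integers in a fixed algebraic closure $\overline{\mathbb{Q}}$ of $\mathbb{Q}$. $\mathrm{Int}_{\mathbb{Q}}(S,\overline{\mathbb{Z}})=\{f\in\mathbb{Q}[X]\mid f(S)\subseteq\overline{\mathbb{Z}}\}$. A regular basis of a ring $R$ with $\mathbb{Z}[X]\subseteq R\subseteq\mathbb{Q}[X]$ is a $\mathbb{Z}$-module basis $\{b_n\}_{n\ge0}$ of $R$ such that $\deg b_n=n$ for each $n$. For $f\in\mathbb{Z}[X]$ monic (nonconstant) and an integer $d\ge1$, $\mathscr{S}(f,d)=\bigcup_{\alpha\in\overline{\mathbb{Z}}}\mathcal{Z}(f(X)-d\alpha)$, where $\mathcal{Z}(f(X)-d\alpha)\subseteq\overline{\mathbb{Z}}$ is the set of all roots of $f(X)-d\alpha$. In $\mathscr{F}$ each element is regarded with its given presentation $f=f_n$, $d=d_n$. The polynomial closure of $S$ in $\overline{\mathbb{Z}}$ is the largest subset $T\subseteq\overline{\mathbb{Z}}$ containing $S$ such that $\mathrm{Int}_{\mathbb{Q}}(S,\overline{\mathbb{Z}})=\mathrm{Int}_{\mathbb{Q}}(T,\overline{\mathbb{Z}})$. *)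

theory Defs
  imports Complex_Main "HOL-Computational_Algebra.Polynomial"
begin

(* The fixed algebraic closure of the rationals is the field of algebraic numbers inside the
   complex numbers, so that this is the ring of all algebraic integers. *)
definition Zbar :: "complex set" where
  "Zbar = {z. algebraic_int z}"

definition Int_Q :: "complex set \<Rightarrow> rat poly set" where
  "Int_Q S = {f. (\<lambda>z. poly (map_poly of_rat f) z) ` S \<subseteq> Zbar}"

(* The ring of integer polynomials as a subring of the rational polynomials. *)
definition int_polys :: "rat poly set" where
  "int_polys = range (map_poly of_int)"

definition int_scale :: "int \<Rightarrow> rat poly \<Rightarrow> rat poly" where
  "int_scale k p = smult (of_int k) p"

interpretation int_scale: module int_scale
  by unfold_locales (simp_all add: int_scale_def smult_add_right smult_add_left)

(* The degree condition already makes b injective, so independence of its range is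
   independence of the family b; in particular b 0 is nonzero. *)
definition regular_basis :: "rat poly set \<Rightarrow> (nat \<Rightarrow> rat poly) \<Rightarrow> bool" where
  "regular_basis R b \<longleftrightarrow>
     int_scale.independent (range b) \<and> int_scale.span (range b) = R \<and> (\<forall>n. degree (b n) = n)"

definition frac_poly :: "int poly \<Rightarrow> nat \<Rightarrow> rat poly" where
  "frac_poly f d = smult (1 / of_nat d) (map_poly of_int f)"

definition root_set :: "complex poly \<Rightarrow> complex set" where
  "root_set p = {z. poly p z = 0}"

(* Roots are taken among all complex numbers; for f monic and nonconstant they are automatically
   algebraic integers, see scrS_subset_Zbar. *)
definition scrS :: "int poly \<Rightarrow> nat \<Rightarrow> complex set" where
  "scrS f d = (\<Union>\<alpha>\<in>Zbar. root_set (map_poly of_int f - [:of_nat d * \<alpha>:]))"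

(* Polynomial fractions are kept as pairs (numerator, denominator), because scrS depends on
   the given presentation. *)
definition scrF :: "(nat \<Rightarrow> int poly) \<Rightarrow> (nat \<Rightarrow> nat) \<Rightarrow> (int poly \<times> nat) set" where
  "scrF f d = {(f n, d n) | n. d n \<ge> 2}"

(* The largest set with the stated property; it exists by polynomial_closure_largest. *)
definition polynomial_closure :: "complex set \<Rightarrow> complex set" where
  "polynomial_closure S = (GREATEST T. S \<subseteq> T \<and> T \<subseteq> Zbar \<and> Int_Q S = Int_Q T)"

lemma polynomial_closure_largest:
  assumes "S \<subseteq> Zbar"
  shows "S \<subseteq> polynomial_closure S" "polynomial_closure S \<subseteq> Zbar"
    "Int_Q S = Int_Q (polynomial_closure S)"
    "\<And>T. S \<subseteq> T \<Longrightarrow> T \<subseteq> Zbar \<Longrightarrow> Int_Q S = Int_Q T \<Longrightarrow> T \<subseteq> polynomial_closure S"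
proof -
  let ?P = "\<lambda>T. S \<subseteq> T \<and> T \<subseteq> Zbar \<and> Int_Q S = Int_Q T"
  let ?T = "{z \<in> Zbar. \<forall>f\<in>Int_Q S. poly (map_poly of_rat f) z \<in> Zbar}"
  have sub: "S \<subseteq> ?T" using assms by (auto simp: Int_Q_def)
  have "Int_Q S = Int_Q ?T"
  proof (intro subset_antisym subsetI)
    show "g \<in> Int_Q ?T" if "g \<in> Int_Q S" for g
      using that by (auto simp: Int_Q_def[of ?T])
    show "g \<in> Int_Q S" if "g \<in> Int_Q ?T" for g
      using that sub unfolding Int_Q_def by blast
  qed
  then have T: "?P ?T" using sub by blast
  have max: "T \<subseteq> ?T" if "?P T" for T
  proof
    fix z assume z: "z \<in> T"
    have "poly (map_poly of_rat g) z \<in> Zbar" if "g \<in> Int_Q S" for g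
    proof -
      have "g \<in> Int_Q T" using that \<open>?P T\<close> by blast
      then show ?thesis using z by (auto simp: Int_Q_def)
    qed
    then show "z \<in> ?T" using z \<open>?P T\<close> by blast
  qed
  have "Greatest ?P = ?T" by (rule Greatest_equality[of ?P, OF T max])
  then have eq: "polynomial_closure S = ?T" by (simp only: polynomial_closure_def)
  show "S \<subseteq> polynomial_closure S" "polynomial_closure S \<subseteq> Zbar"
    "Int_Q S = Int_Q (polynomial_closure S)"
    using T by (simp_all only: eq)
  show "T \<subseteq> polynomial_closure S" if "S \<subseteq> T" "T \<subseteq> Zbar" "Int_Q S = Int_Q T" for T
    unfolding eq by (rule max) (use that in blast)
qed

lemma algebraic_int_nat_mult:
  assumes "algebraic_int (a :: complex)"
  shows "algebraic_int (of_nat d * a)"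
proof (cases "d = 0")
  case False
  from assms obtain p where p: "lead_coeff p = 1" "\<And>i. coeff p i \<in> \<int>" "poly p a = 0"
    by (auto simp: algebraic_int.simps)
  define n where "n = degree p"
  define q where "q = (\<Sum>i\<le>n. monom (coeff p i * of_nat d ^ (n - i)) i)"
  have coeff_q: "coeff q i = (if i \<le> n then coeff p i * of_nat d ^ (n - i) else 0)" for i
    by (simp add: q_def coeff_sum)
  have deg: "degree q = n"
  proof (rule antisym)
    show "degree q \<le> n" by (rule degree_le) (simp add: coeff_q)
    show "n \<le> degree q" by (rule le_degree) (use p(1) in \<open>simp add: coeff_q n_def\<close>)
  qed
  have "poly q (of_nat d * a) = (\<Sum>i\<le>n. coeff p i * of_nat d ^ (n - i) * (of_nat d * a) ^ i)"
    by (simp add: q_def poly_sum poly_monom)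
  also have "\<dots> = (\<Sum>i\<le>n. of_nat d ^ n * (coeff p i * a ^ i))"
    by (rule sum.cong) (auto simp: power_mult_distrib power_diff False)
  also have "\<dots> = of_nat d ^ n * poly p a"
    by (simp add: poly_altdef n_def sum_distrib_left)
  finally have "poly q (of_nat d * a) = 0" using p(3) by simp
  moreover have "lead_coeff q = 1" using p(1) by (simp add: deg coeff_q n_def)
  moreover have "coeff q i \<in> \<int>" for i using p(2) by (auto simp: coeff_q)
  ultimately show ?thesis by (auto simp: algebraic_int.simps)
qed auto

lemma scrS_subset_Zbar:
  assumes "lead_coeff f = 1" "degree f > 0"
  shows "scrS f d \<subseteq> Zbar"
proof
  fix z assume "z \<in> scrS f d"
  then obtain a where a: "algebraic_int a" "poly (map_poly of_int f) z = of_nat d * a"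
    by (auto simp: scrS_def root_set_def Zbar_def)
  have deg: "degree (map_poly of_int f :: complex poly) = degree f"
    by (rule map_poly_degree_eq) (use assms in auto)
  have "algebraic_int z"
    by (rule algebraic_int_root[OF algebraic_int_nat_mult[OF a(1)] a(2)])
       (use assms deg in \<open>auto simp: coeff_map_poly\<close>)
  then show "z \<in> Zbar" by (simp add: Zbar_def)
qed

end

theory Submission
  imports Defs "Jordan_Normal_Form.Char_Poly"
begin

text \<open>
  The regular basis generates \<^term>\<open>Int_Q S\<close> as an abelian group, so whether a point
  \<open>z\<close> has integral values under all of \<^term>\<open>Int_Q S\<close> can be tested on the basis elements
  \<open>f n / d n\<close> alone, because the algebraic integers are closed under integer linear combinations
  (lemma \<open>span_frac_poly_value\<close>). An element with \<open>d n = 1\<close> is an integer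
  polynomial and is integral at every algebraic integer, so only the elements with
  \<open>d n \<ge> 2\<close> impose a condition, and \<open>f n (z) / d n\<close> being integral is exactly membership of
  \<open>z\<close> in \<^term>\<open>scrS (f n) (d n)\<close> (lemma \<open>mem_scrS_iff\<close>). That gives the closure.

  For nontriviality, a basis element with \<open>d n \<ge> 2\<close> has the leading coefficient
  \<open>1 / d n\<close>, which is not an integer. If there is none, then the basis consists of monic
  integer polynomials, one of each degree, and division with remainder shows that it generates
  all integer polynomials.

  What remains is that the algebraic integers form a ring. A number that maps a nonzero finitely
  generated group of numbers into itself by multiplication is an eigenvalue of an integer matrix,
  hence a root of its monic characteristic polynomial (lemma
  \<open>algebraic_int_if_stable_span\<close>). If \<open>a\<close> and \<open>b\<close> satisfy monic
  integer equations of degrees \<open>m\<close> and \<open>n\<close>, then the group generated by the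
  products \<open>a ^ i * b ^ j\<close> with \<open>i < m\<close> and \<open>j < n\<close> is
  mapped into itself by \<open>a\<close> and by \<open>b\<close>, hence by \<open>a + b\<close> and \<open>a * b\<close>.
\<close>

section \<open>The ring of algebraic integers\<close>

text \<open>
  The span in this module is the additive subgroup generated by a set, so it also expresses
  finite generation inside a field, where only the group structure over the integers matters.
\<close>

interpretation int_mult: Modules.module "\<lambda>(k :: int) (x :: 'a :: comm_ring_1). of_int k * x"
  by unfold_locales (simp_all add: algebra_simps)

text \<open>
  Writing the products of \<open>x\<close> with the generators as integer combinations of the generators gives
  an integer matrix for which the vector of generators is an eigenvector; it is nonzero because
  one of the generators is.
\<close>

lemma algebraic_int_if_stable_span:
  fixes x :: "'a :: field_char_0"
  assumes B: "finite B" "b \<in> B" "b \<noteq> 0"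
    and stable: "\<And>y. y \<in> B \<Longrightarrow> x * y \<in> int_mult.span B"
  shows "algebraic_int x"
proof -
  have "\<forall>y\<in>B. \<exists>c. x * y = (\<Sum>z\<in>B. of_int (c z) * z)"
    using stable int_mult.span_finite[OF B(1)] by fastforce
  then obtain c where c: "\<And>y. y \<in> B \<Longrightarrow> x * y = (\<Sum>z\<in>B. of_int (c y z) * z)"
    by metis
  obtain xs where xs: "set xs = B" "distinct xs"
    using finite_distinct_list[OF B(1)] by blast
  define n where "n = length xs"
  define A where "A = mat n n (\<lambda>(i, j). c (xs ! i) (xs ! j))"
  define M where "M = map_mat (of_int :: int \<Rightarrow> 'a) A"
  define v where "v = vec n (\<lambda>i. xs ! i)"
  have A: "A \<in> carrier_mat n n" and M: "M \<in> carrier_mat n n"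
    by (simp_all add: A_def M_def)
  have bij: "bij_betw (\<lambda>i. xs ! i) {..<n} B"
    using xs bij_betw_nth[of xs "{..<n}" B] by (simp add: n_def)
  have "M *\<^sub>v v = x \<cdot>\<^sub>v v"
  proof (rule eq_vecI)
    fix i assume "i < dim_vec (x \<cdot>\<^sub>v v)"
    then have i: "i < n" by (simp add: v_def)
    then have "x * xs ! i = (\<Sum>z\<in>B. of_int (c (xs ! i) z) * z)"
      using xs by (intro c) (auto simp: n_def)
    also have "\<dots> = (\<Sum>j<n. of_int (c (xs ! i) (xs ! j)) * xs ! j)"
      by (rule sum.reindex_bij_betw[OF bij, symmetric])
    finally show "(M *\<^sub>v v) $ i = (x \<cdot>\<^sub>v v) $ i"
      using i by (simp add: M_def A_def v_def scalar_prod_def atLeast0LessThan)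
  qed (simp add: M_def A_def v_def)
  moreover have "v \<noteq> 0\<^sub>v n"
  proof
    obtain i where "i < n" "xs ! i = b" using B(2) xs by (auto simp: n_def in_set_conv_nth)
    moreover assume "v = 0\<^sub>v n"
    then have "v $ i = 0\<^sub>v n $ i" by simp
    ultimately show False using B(3) by (simp add: v_def)
  qed
  ultimately have "eigenvalue M x"
    unfolding eigenvalue_def eigenvector_def by (intro exI[of _ v]) (simp add: M_def A_def v_def)
  then have "poly (char_poly M) x = 0"
    by (simp only: eigenvalue_root_char_poly[OF M])
  then have "poly (map_poly of_int (char_poly A)) x = 0"
    unfolding M_def of_int_hom.char_poly_hom[OF A] .
  moreover have "lead_coeff (char_poly A) = 1"
    using degree_monic_char_poly[OF A] by simp
  ultimately show ?thesis by (auto simp: algebraic_int_altdef_ipoly)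
qed

lemma mult_maps_int_span:
  fixes B :: "'a :: comm_ring_1 set"
  assumes "\<And>y. y \<in> B \<Longrightarrow> x * y \<in> int_mult.span B" and "y \<in> int_mult.span B"
  shows "x * y \<in> int_mult.span B"
  using assms(2)
proof (induction rule: int_mult.span_induct_alt)
  case (step k u v)
  have "x * (of_int k * u + v) = of_int k * (x * u) + x * v" by (simp add: algebra_simps)
  then show ?case
    using step assms(1) by (simp add: int_mult.span_add int_mult.span_scale)
qed (simp add: int_mult.span_zero)

text \<open>
  Multiplication by \<open>a\<close> only shifts the exponent, except at the top power, which the monic
  equation rewrites in the lower ones.
\<close>

lemma monic_root_mult_power:
  fixes a :: "'a :: comm_ring_1"
  assumes p: "poly (map_poly of_int p) a = 0" "lead_coeff p = 1" and "i < degree p"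
  shows "a * (a ^ i * c) \<in> int_mult.span ((\<lambda>k. a ^ k * c) ` {..<degree p})"
proof (cases "Suc i = degree p")
  case False
  then have "a ^ Suc i * c \<in> (\<lambda>k. a ^ k * c) ` {..<degree p}"
    using assms(3) by (intro imageI) simp
  then show ?thesis by (simp add: int_mult.span_base mult.assoc)
next
  case True
  have "degree (map_poly of_int p :: 'a poly) = degree p"
    by (rule map_poly_degree_eq) (simp add: p(2))
  then have "0 = (\<Sum>k\<le>degree p. of_int (coeff p k) * a ^ k)"
    using p(1) by (simp add: poly_altdef coeff_map_poly)
  also have "\<dots> = (\<Sum>k<degree p. of_int (coeff p k) * a ^ k) + a ^ degree p"
    using p(2) by (simp flip: lessThan_Suc_atMost)
  finally have eq: "a ^ degree p = - (\<Sum>k<degree p. of_int (coeff p k) * a ^ k)"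
    by (simp add: eq_neg_iff_add_eq_0 add.commute)
  have "a * (a ^ i * c) = a ^ degree p * c"
    by (simp flip: True add: mult.assoc)
  also have "\<dots> = - (\<Sum>k<degree p. of_int (coeff p k) * (a ^ k * c))"
    unfolding eq by (simp add: sum_distrib_right mult.assoc)
  also have "\<dots> \<in> int_mult.span ((\<lambda>k. a ^ k * c) ` {..<degree p})"
    by (intro int_mult.span_neg int_mult.span_sum int_mult.span_scale int_mult.span_base) auto
  finally show ?thesis .
qed

text \<open>
  For sums and products a single group is needed that both factors map into itself; the products
  of powers below the degrees of the two equations generate one.
\<close>

lemma algebraic_int_common_span:
  fixes a b :: "'a :: field_char_0"
  assumes "algebraic_int a" "algebraic_int b"
  obtains B :: "'a set" where "finite B" "1 \<in> B"
    "\<And>y. y \<in> int_mult.span B \<Longrightarrow> a * y \<in> int_mult.span B"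
    "\<And>y. y \<in> int_mult.span B \<Longrightarrow> b * y \<in> int_mult.span B"
proof -
  obtain p q where p: "poly (map_poly of_int p) a = 0" "lead_coeff p = 1"
    and q: "poly (map_poly of_int q) b = 0" "lead_coeff q = 1"
    using assms by (auto simp: algebraic_int_altdef_ipoly)
  have pos: "degree r > 0" if "poly (map_poly of_int r) x = 0" "lead_coeff r = 1"
    for r and x :: 'a
    using that by (intro Nat.gr0I) (auto elim!: degree_eq_zeroE)
  define B where "B = (\<lambda>(i, j). a ^ i * b ^ j) ` ({..<degree p} \<times> {..<degree q})"
  show ?thesis
  proof (rule that)
    show "finite B" by (simp add: B_def)
    show "1 \<in> B"
      unfolding B_def by (rule image_eqI[of _ _ "(0, 0)"]) (use pos p q in auto)
    have "a * y \<in> int_mult.span B" if y: "y \<in> B" for y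
    proof -
      obtain i j where ij: "i < degree p" "j < degree q" "y = a ^ i * b ^ j"
        using y by (auto simp: B_def)
      have "(\<lambda>k. a ^ k * b ^ j) ` {..<degree p} \<subseteq> B" using ij by (auto simp: B_def)
      then show ?thesis
        using monic_root_mult_power[OF p ij(1)] int_mult.span_mono ij(3) by blast
    qed
    then show "a * y \<in> int_mult.span B" if "y \<in> int_mult.span B" for y
      using that by (rule mult_maps_int_span)
    have "b * y \<in> int_mult.span B" if y: "y \<in> B" for y
    proof -
      obtain i j where ij: "i < degree p" "j < degree q" "y = b ^ j * a ^ i"
        using y unfolding B_def by (auto simp: mult.commute[of "b ^ _"])
      have "(\<lambda>k. b ^ k * a ^ i) ` {..<degree q} \<subseteq> B"
        using ij by (auto simp: B_def mult.commute)
      then show ?thesis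
        using monic_root_mult_power[OF q ij(2)] int_mult.span_mono ij(3) by blast
    qed
    then show "b * y \<in> int_mult.span B" if "y \<in> int_mult.span B" for y
      using that by (rule mult_maps_int_span)
  qed
qed

lemma algebraic_int_add:
  fixes a b :: "'a :: field_char_0"
  assumes "algebraic_int a" "algebraic_int b"
  shows "algebraic_int (a + b)"
proof -
  obtain B where B: "finite B" "1 \<in> B"
    "\<And>y. y \<in> int_mult.span B \<Longrightarrow> a * y \<in> int_mult.span B"
    "\<And>y. y \<in> int_mult.span B \<Longrightarrow> b * y \<in> int_mult.span B"
    using algebraic_int_common_span[OF assms] by blast
  show ?thesis
    by (rule algebraic_int_if_stable_span[OF B(1,2)])
      (use B in \<open>simp_all add: distrib_right int_mult.span_add int_mult.span_base\<close>)
qed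

lemma algebraic_int_mult:
  fixes a b :: "'a :: field_char_0"
  assumes "algebraic_int a" "algebraic_int b"
  shows "algebraic_int (a * b)"
proof -
  obtain B where B: "finite B" "1 \<in> B"
    "\<And>y. y \<in> int_mult.span B \<Longrightarrow> a * y \<in> int_mult.span B"
    "\<And>y. y \<in> int_mult.span B \<Longrightarrow> b * y \<in> int_mult.span B"
    using algebraic_int_common_span[OF assms] by blast
  show ?thesis
    by (rule algebraic_int_if_stable_span[OF B(1,2)])
      (use B in \<open>simp_all add: mult.assoc int_mult.span_base\<close>)
qed

lemma algebraic_int_int_poly_value:
  fixes z :: "'a :: field_char_0"
  assumes "algebraic_int z"
  shows "algebraic_int (poly (map_poly of_int p) z)"
  using assms by (induction p) (simp_all add: map_poly_pCons algebraic_int_add algebraic_int_mult)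

section \<open>Values of a regular basis\<close>

lemma poly_frac_poly:
  "poly (map_poly of_rat (frac_poly f d)) (z :: complex) = poly (map_poly of_int f) z / of_nat d"
proof -
  have "map_poly of_rat (frac_poly f d) = Polynomial.smult (1 / of_nat d) (map_poly of_int f :: complex poly)"
    by (rule poly_eqI) (simp add: frac_poly_def coeff_map_poly of_rat_mult of_rat_divide)
  then show ?thesis by simp
qed

lemma mem_scrS_iff:
  assumes "d > 0"
  shows "z \<in> scrS f d \<longleftrightarrow> poly (map_poly of_rat (frac_poly f d)) z \<in> Zbar"
proof
  assume "z \<in> scrS f d"
  then obtain \<alpha> where "\<alpha> \<in> Zbar" "poly (map_poly of_int f) z = of_nat d * \<alpha>"
    by (auto simp: scrS_def root_set_def)
  then show "poly (map_poly of_rat (frac_poly f d)) z \<in> Zbar"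
    using assms by (simp add: poly_frac_poly)
next
  assume "poly (map_poly of_rat (frac_poly f d)) z \<in> Zbar"
  then show "z \<in> scrS f d"
    using assms unfolding scrS_def root_set_def poly_frac_poly
    by (intro UN_I) auto
qed

lemma span_value_Zbar:
  assumes "g \<in> int_scale.span G" and "\<And>h. h \<in> G \<Longrightarrow> poly (map_poly of_rat h) z \<in> Zbar"
  shows "poly (map_poly of_rat g) z \<in> Zbar"
  using assms(1)
proof (induction rule: int_scale.span_induct_alt)
  case base
  show ?case by (simp add: Zbar_def)
next
  case (step k u v)
  have "map_poly of_rat (int_scale k u + v) =
      Polynomial.smult (of_int k) (map_poly of_rat u) + (map_poly of_rat v :: complex poly)"
    by (rule poly_eqI) (simp add: int_scale_def coeff_map_poly of_rat_add of_rat_mult)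
  then show ?case
    using step assms(2)[of u] by (simp add: Zbar_def algebraic_int_add algebraic_int_mult)
qed

lemma span_frac_poly_value:
  assumes z: "z \<in> Zbar" and pos: "\<And>n. d n > 0"
    and scrS: "\<And>n. d n \<ge> 2 \<Longrightarrow> z \<in> scrS (f n) (d n)"
    and g: "g \<in> int_scale.span (range (\<lambda>n. frac_poly (f n) (d n)))"
  shows "poly (map_poly of_rat g) z \<in> Zbar"
  using g
proof (rule span_value_Zbar)
  fix h assume "h \<in> range (\<lambda>n. frac_poly (f n) (d n))"
  then obtain n where h: "h = frac_poly (f n) (d n)" by blast
  show "poly (map_poly of_rat h) z \<in> Zbar"
  proof (cases "d n = 1")
    case True
    then show ?thesis
      using z by (simp add: h poly_frac_poly Zbar_def algebraic_int_int_poly_value)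
  next
    case False
    then have "d n \<ge> 2" using pos[of n] by simp
    from scrS[OF this] show ?thesis using mem_scrS_iff[OF pos] by (simp add: h)
  qed
qed

section \<open>Nontriviality\<close>

lemma frac_poly_not_int:
  assumes "lead_coeff f = 1" "d \<ge> 2"
  shows "frac_poly f d \<notin> int_polys"
proof
  assume "frac_poly f d \<in> int_polys"
  then obtain p where "frac_poly f d = map_poly of_int p" by (auto simp: int_polys_def)
  then have "coeff (frac_poly f d) (degree f) = of_int (coeff p (degree f))"
    by (simp add: coeff_map_poly)
  moreover have "coeff (frac_poly f d) (degree f) = 1 / of_nat d"
    using assms(1) by (simp add: frac_poly_def coeff_map_poly)
  ultimately have "(1 :: rat) = of_int (coeff p (degree f) * int d)"
    using assms(2) by (simp add: field_simps)
  then have "coeff p (degree f) * int d = 1" by (metis of_int_eq_1_iff)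
  then have "int d dvd 1" by (metis dvd_triv_right)
  then show False using assms(2) by simp
qed

text \<open>
  Subtracting the leading coefficient times the basis element of the same degree leaves a
  polynomial of smaller degree.
\<close>

lemma int_polys_subset_span_monic:
  fixes f :: "nat \<Rightarrow> int poly"
  assumes deg: "\<And>n. degree (f n) = n" and monic: "\<And>n. lead_coeff (f n) = 1"
  shows "map_poly of_int p \<in> int_scale.span (range (\<lambda>n. map_poly of_int (f n)))"
proof (induction "degree p" arbitrary: p rule: less_induct)
  case less
  let ?n = "degree p" and ?c = "lead_coeff p"
  let ?q = "p - Polynomial.smult ?c (f ?n)"
  have eq: "map_poly of_int p = int_scale ?c (map_poly of_int (f ?n)) + map_poly of_int ?q"
    by (rule poly_eqI) (simp add: int_scale_def coeff_map_poly)
  have "map_poly of_int ?q \<in> int_scale.span (range (\<lambda>n. map_poly of_int (f n)))"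
  proof (cases "?q = 0")
    case True
    then show ?thesis by (simp add: int_scale.span_zero)
  next
    case False
    have "coeff ?q i = 0" if "i \<ge> ?n" for i
      using that deg[of ?n] monic[of ?n]
      by (cases "i = ?n") (simp_all add: coeff_eq_0)
    then have "degree ?q < ?n" using False by (meson leading_coeff_0_iff not_le)
    then show ?thesis by (rule less)
  qed
  then show ?case
    unfolding eq by (intro int_scale.span_add int_scale.span_scale) (auto intro: int_scale.span_base)
qed

lemma span_int_polys_subset:
  assumes "G \<subseteq> int_polys"
  shows "int_scale.span G \<subseteq> int_polys"
proof
  fix g assume "g \<in> int_scale.span G"
  then show "g \<in> int_polys"
  proof (induction rule: int_scale.span_induct_alt)
    case base
    show ?case unfolding int_polys_def by (rule range_eqI[of _ _ 0]) simp
  next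
    case (step k u v)
    then obtain p q where "u = map_poly of_int p" "v = map_poly of_int q"
      using assms by (auto simp: int_polys_def)
    then have "int_scale k u + v = map_poly of_int (Polynomial.smult k p + q)"
      by (intro poly_eqI) (simp add: int_scale_def coeff_map_poly)
    then show ?case by (auto simp: int_polys_def)
  qed
qed

section \<open>Nontriviality and closure from a regular basis\<close>

theorem theorem6p5:
  fixes S :: "complex set" and f :: "nat \<Rightarrow> int poly" and d :: "nat \<Rightarrow> nat"
  assumes "S \<subseteq> Zbar"
    and "\<And>n. lead_coeff (f n) = 1"
    and "\<And>n. d n > 0"
    and "regular_basis (Int_Q S) (\<lambda>n. frac_poly (f n) (d n))"
  shows "(Int_Q S \<noteq> int_polys \<longleftrightarrow> scrF f d \<noteq> {}) \<and>
    polynomial_closure S = Zbar \<inter> (\<Inter>(g, e)\<in>scrF f d. scrS g e)"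
proof -
  let ?b = "\<lambda>n. frac_poly (f n) (d n)"
  have span: "int_scale.span (range ?b) = Int_Q S" and deg_b: "\<And>n. degree (?b n) = n"
    using assms(4) by (auto simp: regular_basis_def)
  have b: "?b n \<in> Int_Q S" for n
    unfolding span[symmetric] by (rule int_scale.span_base) simp
  have "Int_Q S \<noteq> int_polys" if "scrF f d \<noteq> {}"
  proof -
    obtain n where "d n \<ge> 2" using \<open>scrF f d \<noteq> {}\<close> by (auto simp: scrF_def)
    then show ?thesis using frac_poly_not_int[OF assms(2)] b[of n] by blast
  qed
  moreover have "Int_Q S = int_polys" if "scrF f d = {}"
  proof -
    have "d n = 1" for n
    proof -
      have "\<not> d n \<ge> 2" using \<open>scrF f d = {}\<close> by (auto simp: scrF_def)
      then show ?thesis using assms(3)[of n] by simp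
    qed
    then have b_int: "?b n = map_poly of_int (f n)" for n by (simp add: frac_poly_def)
    have deg_f: "degree (f n) = n" for n
      using deg_b[of n] unfolding b_int by (simp add: map_poly_degree_eq)
    show ?thesis
    proof
      show "Int_Q S \<subseteq> int_polys"
        unfolding span[symmetric] by (rule span_int_polys_subset) (auto simp: b_int int_polys_def)
      show "int_polys \<subseteq> Int_Q S"
        unfolding span[symmetric] b_int int_polys_def
        using int_polys_subset_span_monic[OF deg_f assms(2)] by blast
    qed
  qed
  moreover have "polynomial_closure S = Zbar \<inter> (\<Inter>(g, e)\<in>scrF f d. scrS g e)"
    (is "_ = ?T")
  proof
    note closure = polynomial_closure_largest[OF assms(1)]
    \<comment> \<open>Both the closure and \<open>S\<close> itself are instances of \<open>R\<close>.\<close>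
    have T: "z \<in> ?T" if "Int_Q R = Int_Q S" "R \<subseteq> Zbar" "z \<in> R" for z R
    proof -
      have "z \<in> scrS (f n) (d n)" for n
      proof -
        have "?b n \<in> Int_Q R" using b that(1) by simp
        then show ?thesis using that(3) mem_scrS_iff[OF assms(3)] by (auto simp: Int_Q_def)
      qed
      then show ?thesis using that by (auto simp: scrF_def)
    qed
    show "polynomial_closure S \<subseteq> ?T"
      using T closure(2) closure(3)[symmetric] by blast
    have S: "S \<subseteq> ?T" using T assms(1) by blast
    have "Int_Q S = Int_Q ?T"
    proof
      show "Int_Q S \<subseteq> Int_Q ?T"
      proof
        fix g assume "g \<in> Int_Q S"
        then have g: "g \<in> int_scale.span (range ?b)" by (simp add: span)
        have "poly (map_poly of_rat g) z \<in> Zbar" if "z \<in> ?T" for z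
          by (rule span_frac_poly_value[OF _ assms(3) _ g]) (use that in \<open>auto simp: scrF_def\<close>)
        then show "g \<in> Int_Q ?T" by (auto simp: Int_Q_def)
      qed
      show "Int_Q ?T \<subseteq> Int_Q S" using S unfolding Int_Q_def by blast
    qed
    then show "?T \<subseteq> polynomial_closure S" by (intro closure(4) S) auto
  qed
  ultimately show ?thesis by blast
qed

end
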